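(* For each $r$-tuple $\mathfrak{s}=(s_1,\ldots,s_r)\in\mathbb{N}^r$, with $(E',\rho)$ and $\mathbf{v}_{\mathfrak{s}}\in E'(\overline{k})$ the $t$-module and point attached to $\mathfrak{s}$ (defined in the context): (a) the $t$-module $E'$ is defined over $A$, i.e. $\rho_t\in\mathrm{Mat}_d(A[\tau])$; (b) the point $\mathbf{v}_{\mathfrak{s}}$ is an integral point in $E'(A)=\mathrm{Mat}_{d\times1}(A)$.
   Context: Notation. $\mathbb{N}$ is the set of positive integers; $q$ is a power of a prime $p$; $\theta,t$ are independent variables; $A=\mathbb{F}_q[\theta]$, $k=\mathbb{F}_q(\theta)$, $\overline{k}$ an algebraic closure of $k$. Anderson–Thakur polynomials. Let $D_0=1$, $D_i=\prod_{j=0}^{i-1}(\theta^{q^i}-\theta^{q^j})$. For $n=\sum_i n_iq^i\geq 0$ with $0\le n_i\le q-1$, $\Gamma_{n+1}=\prod_iD_i^{n_i}\in A$. $G_0(y)=1$, $G_n(y)=\prod_{i=1}^n(t^{q^n}-y^{q^i})$; $H_n\in A[t]$ ($n\geq 0$) is defined by $\big(1-\sum_{i\ge0}\frac{G_i(\theta)}{D_i|_{\theta=t}}x^{q^i}\big)^{-1}=\sum_{n\ge0}\frac{H_n}{\Gamma_{n+1}|_{\theta=t}}x^n$. Frobenius module $M'$. For $f=\sum a_it^i$ put $f^{(-1)}=\sum a_i^{1/q}t^i$. $\overline{k}[t,\sigma]$ is the noncommutative $\overline{k}[t]$-algebra generated by $\sigma$ with $\sigma f=f^{(-1)}\sigma$.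 Let $M'$ be the left $\overline{k}[t,\sigma]$-module, free over $\overline{k}[t]$ with basis $m_1,\ldots,m_r$, with $\sigma m_1=(t-\theta)^{s_1+\cdots+s_r}m_1$ and $\sigma m_\ell=H_{s_{\ell-1}-1}^{(-1)}(t-\theta)^{s_{\ell-1}+\cdots+s_r}m_{\ell-1}+(t-\theta)^{s_\ell+\cdots+s_r}m_\ell$ for $2\le\ell\le r$. The $t$-module $(E',\rho)$. Put $d=(s_1+\cdots+s_r)+(s_2+\cdots+s_r)+\cdots+s_r$. $M'$ is a free left $\overline{k}[\sigma]$-module with basis $\nu_1,\ldots,\nu_d$ given, in order, by $(t-\theta)^{s_1+\cdots+s_r-1}m_1,\ldots,(t-\theta)m_1,m_1,\ldots,(t-\theta)^{s_r-1}m_r,\ldots,(t-\theta)m_r,m_r$. Define $\delta:\overline{k}[\sigma]\to\overline{k}$ by $\delta(\sum_ic_i\sigma^i)=\sum_ic_i^{q^i}$ and $\Delta:M'\to\mathrm{Mat}_{d\times1}(\overline{k})$ by $\Delta(\sum u_i\nu_i)=(\delta(u_1),\ldots,\delta(u_d))^{\mathrm{tr}}$. $\Delta$ is surjective, $\mathbb{F}_q$-linear, with kernel $(\sigma-1)M'$, which is stable under $\mathbb{F}_q[t]$; so $\mathrm{Mat}_{d\times1}(\overline{k})$ inherits an $\mathbb{F}_q[t]$-module structure, given by an $\mathbb{F}_q$-linear ring homomorphism $\rho:\mathbb{F}_q[t]\to\mathrm{Mat}_d(\overline{k}[\tau])$, $\tau$ the $q$-power Frobenius, with $\rho_a(\Delta(m))=\Delta(am)$.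 $(E',\rho)$ is this $t$-module, with $E'(\overline{k})=\mathrm{Mat}_{d\times1}(\overline{k})$. The special point is $\mathbf{v}_{\mathfrak{s}}=\Delta\big(H_{s_r-1}^{(-1)}(t-\theta)^{s_r}m_r\big)$. *)

theory Defs
  imports
    "HOL-Library.Cardinality"
    "HOL-Computational_Algebra.Computational_Algebra"
    "HOL-Algebra.Algebraic_Closure_Type"
    "Jordan_Normal_Form.Matrix"
begin

text \<open>
  The field \<open>F\<^sub>q\<close> is a type of class \<open>finite_field\<close>, so that \<open>q = CARD('a)\<close>.
  Then \<open>A = F\<^sub>q[\<theta>]\<close> is \<open>'a poly\<close>, its fraction field \<open>k\<close> is \<open>'a poly fract\<close>,
  \<open>A[t]\<close> is \<open>'a poly poly\<close> (outer variable \<open>t\<close>, inner variable \<open>\<theta>\<close>), and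
  \<open>F\<^sub>q[t]\<close> is also \<open>'a poly\<close>.
\<close>

type_synonym 'a kbar = "'a poly fract alg_closure"

definition A_to_kbar :: "'a::finite_field poly \<Rightarrow> 'a kbar" where
  "A_to_kbar a = to_ac (to_fract a)"

definition At_to_kbart :: "'a::finite_field poly poly \<Rightarrow> 'a kbar poly" where
  "At_to_kbart = map_poly A_to_kbar"

definition Fqt_to_kbart :: "'a::finite_field poly \<Rightarrow> 'a kbar poly" where
  "Fqt_to_kbart = map_poly (\<lambda>c. A_to_kbar [:c:])"


section \<open>Anderson--Thakur polynomials\<close>

definition carlitz_D :: "nat \<Rightarrow> 'a::finite_field poly" where
  "carlitz_D i = (\<Prod>j<i. monom 1 (CARD('a) ^ i) - monom 1 (CARD('a) ^ j))"

text \<open>\<open>\<Gamma>\<^sub>n\<^sub>+\<^sub>1\<close>; note the shift of the index. The base-\<open>q\<close> digits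
  of \<open>n\<close> at places \<open>i > n\<close> vanish.\<close>

definition carlitz_Gamma_Suc :: "nat \<Rightarrow> 'a::finite_field poly" where
  "carlitz_Gamma_Suc n = (\<Prod>i\<le>n. carlitz_D i ^ (n div CARD('a) ^ i mod CARD('a)))"

definition subst_theta_t :: "'a::finite_field poly \<Rightarrow> 'a poly poly" where
  "subst_theta_t = map_poly (\<lambda>c. [:c:])"

definition theta :: "'a::finite_field poly" where
  "theta = monom 1 1"

definition AT_G :: "nat \<Rightarrow> 'a::finite_field poly poly \<Rightarrow> 'a poly poly" where
  "AT_G n y = (\<Prod>i=1..n. monom 1 (CARD('a) ^ n) - y ^ (CARD('a) ^ i))"

text \<open>The power series \<open>\<Sum>i. G\<^sub>i(\<theta>) / D\<^sub>i|\<^sub>\<theta>\<^sub>=\<^sub>t x^(q^i)\<close>; for each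
  \<open>n\<close> there is at most one \<open>i\<close> with \<open>q^i = n\<close>.\<close>

definition AT_series :: "'a::finite_field poly poly fract fps" where
  "AT_series = Abs_fps (\<lambda>n. \<Sum>i | CARD('a) ^ i = n.
     to_fract (AT_G i [:theta:]) / to_fract (subst_theta_t (carlitz_D i)))"

definition AT_H :: "nat \<Rightarrow> 'a::finite_field poly poly" where
  "AT_H n = (THE h. to_fract h / to_fract (subst_theta_t (carlitz_Gamma_Suc n))
                    = fps_nth (inverse (1 - AT_series)) n)"


section \<open>The Frobenius module\<close>

definition qth_root :: "'a::finite_field kbar \<Rightarrow> 'a kbar" where
  "qth_root x = (THE y. y ^ CARD('a) = x)"

definition inv_twist :: "'a::finite_field kbar poly \<Rightarrow> 'a kbar poly" where
  "inv_twist = map_poly qth_root"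

definition t_minus_theta :: "'a::finite_field kbar poly" where
  "t_minus_theta = monom 1 1 - [:A_to_kbar theta:]"

text \<open>
  A tuple \<open>(s\<^sub>1, \<dots>, s\<^sub>r)\<close> is a list \<open>s\<close>, so that all indices below are
  shifted by one: \<open>s ! l\<close> is the entry number \<open>l + 1\<close>, and \<open>unit_vec r l\<close> is
  the basis element \<open>m\<close> with number \<open>l + 1\<close>. The module \<open>M'\<close> is the free
  module \<open>carrier_vec (length s)\<close> over the polynomials in \<open>t\<close>.
\<close>

definition weight :: "nat list \<Rightarrow> nat \<Rightarrow> nat" where
  "weight s l = sum_list (drop l s)"

definition dimE :: "nat list \<Rightarrow> nat" where
  "dimE s = (\<Sum>l<length s. weight s l)"

abbreviation basis_m :: "nat list \<Rightarrow> nat \<Rightarrow> 'a::finite_field kbar poly vec" where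
  "basis_m s l \<equiv> unit_vec (length s) l"

definition sigma_basis :: "nat list \<Rightarrow> nat \<Rightarrow> 'a::finite_field kbar poly vec" where
  "sigma_basis s l =
     (if l = 0 then t_minus_theta ^ weight s 0 \<cdot>\<^sub>v basis_m s 0
      else (inv_twist (At_to_kbart (AT_H (s ! (l - 1) - 1))) * t_minus_theta ^ weight s (l - 1))
             \<cdot>\<^sub>v basis_m s (l - 1)
           + t_minus_theta ^ weight s l \<cdot>\<^sub>v basis_m s l)"

text \<open>The action of \<open>\<sigma>\<close>: as \<open>\<sigma> f = f\<^sup>(\<^sup>-\<^sup>1\<^sup>) \<sigma>\<close>, it sends
  \<open>\<Sum>l. f\<^sub>l m\<^sub>l\<close> to \<open>\<Sum>l. f\<^sub>l\<^sup>(\<^sup>-\<^sup>1\<^sup>) \<sigma> m\<^sub>l\<close>.\<close>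

definition sigma :: "nat list \<Rightarrow> 'a::finite_field kbar poly vec \<Rightarrow> 'a kbar poly vec" where
  "sigma s f = vec (length s) (\<lambda>j. \<Sum>l<length s. inv_twist (f $ l) * sigma_basis s l $ j)"

text \<open>
  Elements \<open>\<Sum>i. c\<^sub>i \<sigma>\<^sup>i\<close> and \<open>\<Sum>i. c\<^sub>i \<tau>\<^sup>i\<close> of the twisted polynomial rings in
  \<open>\<sigma>\<close> and \<open>\<tau>\<close> are given by their coefficient sequences \<open>c\<close>, stored in the type of
  (commutative) polynomials; the product of that type is never used for them.
\<close>

type_synonym 'a twisted_poly = "'a kbar poly"

definition sigma_act ::
  "nat list \<Rightarrow> 'a::finite_field twisted_poly \<Rightarrow> 'a kbar poly vec \<Rightarrow> 'a kbar poly vec" where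
  "sigma_act s u f =
     vec (length s) (\<lambda>j. \<Sum>i\<le>Polynomial.degree u. smult (poly.coeff u i) ((sigma s ^^ i) f $ j))"

definition nu_basis :: "nat list \<Rightarrow> 'a::finite_field kbar poly vec list" where
  "nu_basis s = concat (map (\<lambda>l. map (\<lambda>j. t_minus_theta ^ j \<cdot>\<^sub>v basis_m s l)
                                       (rev [0..<weight s l])) [0..<length s])"

text \<open>The left module \<open>M'\<close> is free over the twisted polynomials in \<open>\<sigma>\<close> on
  \<open>nu_basis s\<close>, so the coordinates exist and are unique.\<close>

definition nu_coords :: "nat list \<Rightarrow> 'a::finite_field kbar poly vec \<Rightarrow> 'a twisted_poly vec" where
  "nu_coords s f = (THE u. u \<in> carrier_vec (dimE s) \<and>
     f = vec (length s) (\<lambda>j. \<Sum>i<dimE s. sigma_act s (u $ i) (nu_basis s ! i) $ j))"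


section \<open>The t-module\<close>

definition delta :: "'a::finite_field twisted_poly \<Rightarrow> 'a kbar" where
  "delta u = (\<Sum>i\<le>Polynomial.degree u. poly.coeff u i ^ (CARD('a) ^ i))"

definition Delta :: "nat list \<Rightarrow> 'a::finite_field kbar poly vec \<Rightarrow> 'a kbar vec" where
  "Delta s f = map_vec delta (nu_coords s f)"

definition tau_eval :: "'a::finite_field twisted_poly \<Rightarrow> 'a kbar \<Rightarrow> 'a kbar" where
  "tau_eval g x = (\<Sum>i\<le>Polynomial.degree g. poly.coeff g i * x ^ (CARD('a) ^ i))"

definition tau_mat_apply :: "'a::finite_field twisted_poly mat \<Rightarrow> 'a kbar vec \<Rightarrow> 'a kbar vec" where
  "tau_mat_apply R x = vec (dim_row R) (\<lambda>i. \<Sum>j<dim_col R. tau_eval (R $$ (i, j)) (x $ j))"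

text \<open>Since \<open>Delta s\<close> is surjective and a twisted polynomial in \<open>\<tau>\<close> is determined by its
  values on the infinite field \<open>kbar\<close>, the matrix \<open>\<rho>\<^sub>a\<close> is determined by
  \<open>\<rho>\<^sub>a(\<Delta>(m)) = \<Delta>(a m)\<close>.\<close>

definition rho :: "nat list \<Rightarrow> 'a::finite_field poly \<Rightarrow> 'a twisted_poly mat" where
  "rho s a = (THE R. R \<in> carrier_mat (dimE s) (dimE s) \<and>
     (\<forall>m\<in>carrier_vec (length s).
        tau_mat_apply R (Delta s m) = Delta s (Fqt_to_kbart a \<cdot>\<^sub>v m)))"

definition special_point :: "nat list \<Rightarrow> 'a::finite_field kbar vec" where
  "special_point s =
     Delta s ((inv_twist (At_to_kbart (AT_H (last s - 1))) * t_minus_theta ^ last s)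
                \<cdot>\<^sub>v basis_m s (length s - 1))"


section \<open>Integrality\<close>

definition A_tau :: "'a::finite_field twisted_poly set" where
  "A_tau = {g. \<forall>n. poly.coeff g n \<in> range A_to_kbar}"

definition Mat_A_tau :: "nat \<Rightarrow> 'a::finite_field twisted_poly mat set" where
  "Mat_A_tau d = {R \<in> carrier_mat d d. \<forall>i<d. \<forall>j<d. R $$ (i, j) \<in> A_tau}"

definition vec_A :: "nat \<Rightarrow> 'a::finite_field kbar vec set" where
  "vec_A d = {v \<in> carrier_vec d. \<forall>i<d. v $ i \<in> range A_to_kbar}"

end

(*
  In coordinates with respect to m_1, ..., m_r, and with H_j short for the polynomial H_(s_j - 1),
    sigma(g)_j = (t - theta)^(w_j) * (g_j + H_j g_(j+1))^(-1),
  where w_j = s_j + ... + s_r and (-1) is the inverse twist: sigma is a unipotent matrix over A[t],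
  followed by the inverse twist and by a diagonal matrix of powers of t - theta. So division by
  (t - theta)^(w_j) writes every f uniquely as c(f) + sigma(S f), with c(f) a linear combination of
  the nu_i with constant coefficients. The map S is nilpotent on each f, hence
  Delta f = sum_k c(S^k f).
  Both c and S preserve integrality, since only the twist and not its inverse occurs in S, and
  c(x f) = x c(f), S(x f) = x^q S(f) for constants x. Therefore Delta(x f) = sum_k c(S^k f) tau^k(x)
  has coefficients in A for integral f. The columns of rho_t arise from f = t nu_j. The special point
  is Delta(sigma g) = Delta(g) with g integral, because sigma absorbs the inverse twist of H.
  Integrality of the H_n themselves is built into the type of AT_H.
*)
theory Submission
  imports Defs "Jordan_Normal_Form.Char_Poly"
begin

no_notation fps_nth (infixl \<open>$\<close> 75)

subsection \<open>The Frobenius on the algebraic closure\<close>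

lemma of_nat_card_choose:
  assumes "0 < k" "k < CARD('a::finite_field)"
  shows "(of_nat (CARD('a) choose k) :: 'a) = 0"
proof -
  \<comment> \<open>\<open>(X + 1)^q - X^q - 1\<close> has degree less than \<open>q\<close> and vanishes on the field with \<open>q\<close> elements.\<close>
  define P :: "'a poly" where
    "P = (\<Sum>i\<in>{1..<CARD('a)}. monom (of_nat (CARD('a) choose i)) i)"
  have "poly P x = 0" for x
  proof -
    have "{..CARD('a)} = insert 0 (insert CARD('a) {1..<CARD('a)})"
      using assms by auto
    then have "(x + 1) ^ CARD('a) = x ^ CARD('a) + 1 + poly P x"
      using assms by (simp add: binomial_ring P_def poly_sum poly_monom)
    then show ?thesis
      by (simp add: finite_field_power_card_eq_same)
  qed
  moreover have "degree P < CARD('a)"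
    unfolding P_def using assms
    by (intro degree_sum_less) (auto intro: le_less_trans[OF degree_monom_le])
  ultimately have "P = 0"
    using card_poly_roots_bound[of P] by fastforce
  then have "coeff P k = 0"
    by simp
  then show ?thesis
    using assms by (simp add: P_def coeff_sum)
qed

interpretation A_to_kbar: inj_comm_ring_hom "A_to_kbar :: 'a::finite_field poly \<Rightarrow> 'a kbar"
  by unfold_locales (auto simp: A_to_kbar_def)

text \<open>The inner binomial coefficients vanish already in \<open>'a\<close>, and
  \<open>A_to_kbar\<close> carries this over to the closure.\<close>

lemma frobenius_kbar_add:
  "((x :: 'a::finite_field kbar) + y) ^ CARD('a) = x ^ CARD('a) + y ^ CARD('a)"
proof -
  have *: "(of_nat (CARD('a) choose k) :: 'a kbar) = 0" if "0 < k" "k < CARD('a)" for k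
  proof -
    have "(of_nat (CARD('a) choose k) :: 'a kbar)
            = A_to_kbar [:of_nat (CARD('a) choose k):]"
      by (simp flip: of_nat_poly add: A_to_kbar.hom_of_nat)
    then show ?thesis
      using that by (simp add: of_nat_card_choose)
  qed
  have "(x + y) ^ CARD('a) = (\<Sum>k\<le>CARD('a). of_nat (CARD('a) choose k) * x ^ k * y ^ (CARD('a) - k))"
    by (rule binomial_ring)
  also have "\<dots> = (\<Sum>k\<in>{0,CARD('a)}. of_nat (CARD('a) choose k) * x ^ k * y ^ (CARD('a) - k))"
    by (rule sum.mono_neutral_right) (auto simp: *)
  finally show ?thesis
    by (simp add: add.commute)
qed

interpretation frob: inj_comm_ring_hom "\<lambda>x :: 'a::finite_field kbar. x ^ CARD('a)"
proof unfold_locales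
  show "(0 :: 'a kbar) ^ CARD('a) = 0" "(1 :: 'a kbar) ^ CARD('a) = 1"
    by auto
  fix x y :: "'a kbar"
  show "(x * y) ^ CARD('a) = x ^ CARD('a) * y ^ CARD('a)"
    by (rule power_mult_distrib)
  show "(x + y) ^ CARD('a) = x ^ CARD('a) + y ^ CARD('a)"
    by (rule frobenius_kbar_add)
  assume "x ^ CARD('a) = 0"
  then show "x = 0"
    by simp
qed

lemma frobenius_power_kbar_add:
  "((x :: 'a::finite_field kbar) + y) ^ CARD('a) ^ n = x ^ CARD('a) ^ n + y ^ CARD('a) ^ n"
  by (induction n) (simp_all add: power_mult mult.commute[of "CARD('a)"] frob.hom_add)

text \<open>A root exists because the field is algebraically closed, and it is unique because the
  Frobenius is injective. So the description in \<open>qth_root\<close> is met.\<close>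

lemma qth_root_power [simp]: "qth_root (x :: 'a::finite_field kbar) ^ CARD('a) = x"
proof -
  obtain y where "y ^ CARD('a) = x"
    using nth_root_exists[of "CARD('a)" x] by auto
  then show ?thesis
    unfolding qth_root_def by (rule theI) (use \<open>y ^ CARD('a) = x\<close> frob.injectivity in blast)
qed

lemma qth_root_of_power [simp]: "qth_root ((x :: 'a::finite_field kbar) ^ CARD('a)) = x"
  by (rule frob.injectivity) simp

interpretation qth_root: comm_ring_hom "qth_root :: 'a::finite_field kbar \<Rightarrow> _"
proof unfold_locales
  show "qth_root (0 :: 'a kbar) = 0" "qth_root (1 :: 'a kbar) = 1"
    using qth_root_of_power[of "0 :: 'a kbar"] qth_root_of_power[of "1 :: 'a kbar"] by simp_all
  fix x y :: "'a kbar"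
  show "qth_root (x + y) = qth_root x + qth_root y"
    by (rule frob.injectivity) (simp add: frob.hom_add)
  show "qth_root (x * y) = qth_root x * qth_root y"
    by (rule frob.injectivity) (simp add: frob.hom_mult)
qed

section \<open>Twist and inverse twist of polynomials\<close>

definition twist :: "'a::finite_field kbar poly \<Rightarrow> 'a kbar poly" where
  "twist = map_poly (\<lambda>x. x ^ CARD('a))"

lemma coeff_twist [simp]: "coeff (twist p) i = coeff (p :: 'a::finite_field kbar poly) i ^ CARD('a)"
  by (simp add: twist_def)

lemma coeff_inv_twist [simp]: "coeff (inv_twist p) i = qth_root (coeff p i)"
  by (simp add: inv_twist_def)

lemma twist_inv_twist [simp]: "twist (inv_twist p) = p"
  and inv_twist_twist [simp]: "inv_twist (twist p) = p"
  by (auto intro: poly_eqI)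

interpretation twist: comm_ring_hom "twist :: 'a::finite_field kbar poly \<Rightarrow> _"
proof -
  interpret map_poly_comm_ring_hom "\<lambda>x :: 'a kbar. x ^ CARD('a)" ..
  show "comm_ring_hom (twist :: 'a kbar poly \<Rightarrow> _)"
    unfolding twist_def ..
qed

interpretation inv_twist: comm_ring_hom "inv_twist :: 'a::finite_field kbar poly \<Rightarrow> _"
proof -
  interpret map_poly_comm_ring_hom "qth_root :: 'a kbar \<Rightarrow> _" ..
  show "comm_ring_hom (inv_twist :: 'a kbar poly \<Rightarrow> _)"
    unfolding inv_twist_def ..
qed

lemma inv_twist_const [simp]: "inv_twist [:x :: 'a::finite_field kbar:] = [:qth_root x:]"
  by (simp add: inv_twist_def qth_root.map_poly_pCons_hom)

text \<open>The Frobenius kills no nonzero coefficient. The length of \<open>coeffs\<close> replaces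
  the degree in the induction measures below, since it is 0 exactly for the zero polynomial.\<close>

lemma length_coeffs_twist [simp]: "length (coeffs (twist (p :: 'a::finite_field kbar poly))) = length (coeffs p)"
  by (simp add: twist_def)

text \<open>The powers of theta are pairwise distinct. Over an infinite field a twisted polynomial
  can be recovered from its values.\<close>

lemma infinite_kbar: "infinite (UNIV :: 'a::finite_field kbar set)"
proof
  assume "finite (UNIV :: 'a kbar set)"
  moreover have "inj (\<lambda>n. A_to_kbar (monom 1 n) :: 'a kbar)"
    by (rule injI) (metis A_to_kbar.injectivity degree_monom_eq zero_neq_one)
  ultimately have "finite (UNIV :: nat set)"
    using finite_imageD[of "\<lambda>n. A_to_kbar (monom 1 n) :: 'a kbar" UNIV]
    by (meson finite_subset subset_UNIV)
  then show False
    by simp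
qed

subsection \<open>Expansion in powers of t - theta\<close>

text \<open>Substitution of t + theta for t: the coefficients of the result are those of the
  expansion of \<open>p\<close> in powers of t - theta.\<close>

definition taylor :: "'a::finite_field kbar poly \<Rightarrow> 'a kbar poly" where
  "taylor p = p \<circ>\<^sub>p [:A_to_kbar theta, 1:]"

text \<open>The quotient on division by \<open>t_minus_theta ^ w\<close>. Dropping the first
  \<open>w\<close> coefficients and substituting back makes it visible that integrality is
  inherited.\<close>

definition taylor_quot :: "nat \<Rightarrow> 'a::finite_field kbar poly \<Rightarrow> 'a kbar poly" where
  "taylor_quot w p = poly_shift w (taylor p) \<circ>\<^sub>p t_minus_theta"

lemma t_minus_theta_eq: "t_minus_theta = [:- A_to_kbar theta, 1:]"
  by (simp add: t_minus_theta_def monom_Suc)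

interpretation taylor: comm_ring_hom "taylor :: 'a::finite_field kbar poly \<Rightarrow> _"
  by unfold_locales (simp_all add: taylor_def pcompose_add pcompose_mult pcompose_1)

lemma taylor_pcompose [simp]: "taylor (p \<circ>\<^sub>p t_minus_theta) = p"
  and pcompose_taylor [simp]: "taylor p \<circ>\<^sub>p t_minus_theta = p"
  by (simp_all add: taylor_def t_minus_theta_eq pcompose_pCons flip: pcompose_assoc)

lemma taylor_smult [simp]: "taylor (smult x p) = smult x (taylor p)"
  by (simp add: taylor_def pcompose_smult)

lemma taylor_t_minus_theta_power [simp]: "taylor (t_minus_theta ^ n) = monom 1 n"
proof -
  have "taylor t_minus_theta = monom 1 1"
    by (simp add: taylor_def t_minus_theta_eq pcompose_pCons monom_Suc)
  then show ?thesis
    unfolding taylor.hom_power by (metis x_pow_n)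
qed

text \<open>Both substitutions preserve the length, and the shift removes \<open>w\<close> entries.
  The truncated subtraction covers degrees below \<open>w\<close>, where the quotient is 0.\<close>

lemma length_coeffs_taylor_quot:
  "length (coeffs (taylor_quot w p)) = length (coeffs p) - w"
proof -
  have *: "length (coeffs (r \<circ>\<^sub>p [:a, 1:])) = length (coeffs r)" for r and a :: "'a kbar"
    by (cases "r = 0") (simp_all add: length_coeffs_degree pcompose_eq_0_iff degree_pcompose)
  show ?thesis
    by (simp add: taylor_quot_def t_minus_theta_eq * coeffs_shift_poly) (simp add: taylor_def *)
qed

lemma taylor_expansion:
  "p = (\<Sum>j<w. smult (coeff (taylor p) j) (t_minus_theta ^ j)) + t_minus_theta ^ w * taylor_quot w p"
  (is "_ = ?rhs")
proof -
  \<comment> \<open>The map \<open>taylor\<close> is injective and turns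
    \<open>t_minus_theta ^ j\<close> into a monomial, so it suffices to compare coefficients after
    the substitution.\<close>
  have "taylor p = taylor ?rhs"
    by (rule poly_eqI)
      (auto simp: taylor.hom_add taylor.hom_sum taylor.hom_mult taylor_quot_def coeff_sum
        smult_monom coeff_monom_mult coeff_poly_shift)
  then show ?thesis
    using pcompose_taylor[of p] pcompose_taylor[of ?rhs] by simp
qed

text \<open>After \<open>taylor\<close> the sum fills the coefficients below \<open>w\<close> and
  the multiple of \<open>t_minus_theta ^ w\<close> those from \<open>w\<close> on, without
  overlap.\<close>

lemma taylor_expansion_unique:
  assumes "p = (\<Sum>j<w. smult (c j) (t_minus_theta ^ j)) + t_minus_theta ^ w * g"
  shows "j < w \<Longrightarrow> coeff (taylor p) j = c j" and "taylor_quot w p = g"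
proof -
  have *: "coeff (taylor p) j = (if j < w then c j else coeff (taylor g) (j - w))" for j
    by (simp add: assms taylor.hom_add taylor.hom_sum taylor.hom_mult coeff_sum
        smult_monom coeff_monom_mult)
  then show "j < w \<Longrightarrow> coeff (taylor p) j = c j"
    by simp
  have "poly_shift w (taylor p) = taylor g"
    by (rule poly_eqI) (simp add: * coeff_poly_shift)
  then show "taylor_quot w p = g"
    by (simp add: taylor_quot_def)
qed

lemma taylor_quot_add: "taylor_quot w (p + r) = taylor_quot w p + taylor_quot w r"
proof -
  have "poly_shift w (a + b) = poly_shift w a + poly_shift w b" for a b :: "'a kbar poly"
    by (rule poly_eqI) (simp add: coeff_poly_shift)
  then show ?thesis
    by (simp add: taylor_quot_def taylor.hom_add pcompose_add)
qed

lemma taylor_quot_smult: "taylor_quot w (smult x p) = smult x (taylor_quot w p)"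
proof -
  have "poly_shift w (smult x a) = smult x (poly_shift w a)" for a :: "'a kbar poly"
    by (rule poly_eqI) (simp add: coeff_poly_shift)
  then show ?thesis
    by (simp add: taylor_quot_def pcompose_smult)
qed

lemma taylor_quot_0 [simp]: "taylor_quot w 0 = 0"
  by (simp add: taylor_quot_def)


subsection \<open>The decomposition M' = span(nu) + sigma M'\<close>

definition H_poly :: "nat list \<Rightarrow> nat \<Rightarrow> 'a::finite_field kbar poly" where
  "H_poly s j = At_to_kbart (AT_H (s ! j - 1))"

text \<open>The inverse of the bidiagonal matrix with 1 on the diagonal and
  \<open>H_poly s j\<close> to its right in row \<open>j\<close>, written as a finite Neumann
  series. No denominators occur.\<close>

definition unipotent_inv :: "nat list \<Rightarrow> 'a::finite_field kbar poly vec \<Rightarrow> 'a kbar poly vec" where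
  "unipotent_inv s h =
     vec (length s) (\<lambda>j. \<Sum>k\<in>{j..<length s}. (\<Prod>i\<in>{j..<k}. - H_poly s i) * h $ k)"

lemma dim_unipotent_inv [simp]: "dim_vec (unipotent_inv s h) = length s"
  by (simp add: unipotent_inv_def)

text \<open>Splitting off the term \<open>k = j\<close> and pulling \<open>- H_poly s j\<close> out
  of the others leaves the sum at \<open>Suc j\<close>. The \<open>if\<close> covers the last row,
  which has no next component.\<close>

lemma unipotent_inv_rec:
  assumes "j < length s"
  shows "unipotent_inv s h $ j + (if Suc j < length s then H_poly s j * unipotent_inv s h $ Suc j else 0) = h $ j"
proof -
  have "(\<Sum>k\<in>{j..<length s}. (\<Prod>i\<in>{j..<k}. - H_poly s i) * h $ k)
      = h $ j + (\<Sum>k\<in>{Suc j..<length s}. (\<Prod>i\<in>{j..<k}. - H_poly s i) * h $ k)"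
    using assms by (simp add: sum.atLeast_Suc_lessThan)
  also have "(\<Sum>k\<in>{Suc j..<length s}. (\<Prod>i\<in>{j..<k}. - H_poly s i) * h $ k)
      = - H_poly s j * (\<Sum>k\<in>{Suc j..<length s}. (\<Prod>i\<in>{Suc j..<k}. - H_poly s i) * h $ k)"
    unfolding sum_distrib_left
    by (rule sum.cong) (auto simp: prod.atLeast_Suc_lessThan mult.assoc)
  finally show ?thesis
    using assms by (auto simp: unipotent_inv_def)
qed

text \<open>Back substitution: the last row fixes the last entry, and every other row fixes its
  entry from the next one. The induction therefore counts from the end.\<close>

lemma unipotent_inv_unique:
  assumes "dim_vec g = length s"
    and "\<And>j. j < length s \<Longrightarrow> g $ j + (if Suc j < length s then H_poly s j * g $ Suc j else 0) = h $ j"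
  shows "unipotent_inv s h = g"
proof -
  have *: "unipotent_inv s h $ (length s - Suc n) = g $ (length s - Suc n)" if "n < length s" for n
    using that
  proof (induction n)
    case 0
    then show ?case
      using unipotent_inv_rec[of "length s - 1" s h] assms(2)[of "length s - 1"] by simp
  next
    case (Suc n)
    then have *: "Suc (length s - Suc (Suc n)) = length s - Suc n"
      and "length s - Suc n < length s" "length s - Suc (Suc n) < length s"
      by auto
    show ?case
      using unipotent_inv_rec[of "length s - Suc (Suc n)" s h]
        assms(2)[of "length s - Suc (Suc n)"] Suc \<open>length s - Suc n < length s\<close>
        \<open>length s - Suc (Suc n) < length s\<close> unfolding * by simp (metis add_right_cancel)
  qed
  have "unipotent_inv s h $ j = g $ j" if "j < length s" for j
    using *[of "length s - Suc j"] that by (simp add: Suc_diff_Suc)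
  then show ?thesis
    using assms(1) by (intro eq_vecI) auto
qed

section \<open>The map sigma in coordinates\<close>

lemma dim_sigma [simp]: "dim_vec (sigma s f) = length s"
  by (simp add: sigma_def)

text \<open>Row \<open>j\<close> receives contributions from \<open>sigma_basis s j\<close> and
  \<open>sigma_basis s (Suc j)\<close> only. Both carry the factor
  \<open>t_minus_theta ^ weight s j\<close>, and what remains is collected under one inverse twist,
  a ring homomorphism.\<close>

lemma sigma_index:
  fixes g :: "'a::finite_field kbar poly vec"
  assumes "j < length s"
  shows "sigma s g $ j = t_minus_theta ^ weight s j *
           inv_twist (g $ j + (if Suc j < length s then H_poly s j * g $ Suc j else 0))"
proof -
  have "(sigma_basis s l :: 'a kbar poly vec) $ j =
          (if l = j then t_minus_theta ^ weight s j
           else if l = Suc j then inv_twist (H_poly s j) * t_minus_theta ^ weight s j else 0)"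
    if "l < length s" for l
    using assms that by (cases l) (auto simp: sigma_basis_def H_poly_def)
  then have "sigma s g $ j = (\<Sum>l<length s. (if l = j then inv_twist (g $ j) * t_minus_theta ^ weight s j else 0)
      + (if l = Suc j then inv_twist (g $ Suc j) * (inv_twist (H_poly s j) * t_minus_theta ^ weight s j) else 0))"
    using assms by (simp add: sigma_def) (rule sum.cong; simp)
  then show ?thesis
    using assms
    by (simp add: sum.distrib inv_twist.hom_add inv_twist.hom_mult algebra_simps)
qed

lemma sigma_smult:
  "dim_vec f = length s \<Longrightarrow> sigma s (p \<cdot>\<^sub>v f) = inv_twist p \<cdot>\<^sub>v sigma s f"
  by (rule eq_vecI)
    (auto simp: sigma_def inv_twist.hom_mult sum_distrib_left mult.assoc intro!: sum.cong)

lemma sigma_sum_index: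
  assumes "\<And>i. i \<in> I \<Longrightarrow> dim_vec (F i) = length s" and "j < length s"
  shows "sigma s (vec (length s) (\<lambda>k. \<Sum>i\<in>I. F i $ k)) $ j = (\<Sum>i\<in>I. sigma s (F i) $ j)"
proof -
  have "sigma s (vec (length s) (\<lambda>k. \<Sum>i\<in>I. F i $ k)) $ j
      = (\<Sum>l<length s. \<Sum>i\<in>I. inv_twist (F i $ l) * sigma_basis s l $ j)"
    using assms by (auto simp: sigma_def inv_twist.hom_sum sum_distrib_right intro!: sum.cong)
  also have "\<dots> = (\<Sum>i\<in>I. \<Sum>l<length s. inv_twist (F i $ l) * sigma_basis s l $ j)"
    by (rule sum.swap)
  finally show ?thesis
    using assms by (auto simp: sigma_def intro!: sum.cong)
qed

lemma sigma_zero [simp]: "sigma s (0\<^sub>v (length s)) = 0\<^sub>v (length s)"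
  by (rule eq_vecI) (auto simp: sigma_index)

section \<open>The basis nu and its labels\<close>

text \<open>The label \<open>(l, j)\<close> stands for \<open>t_minus_theta ^ j\<close> times
  \<open>basis_m s l\<close>, in the order of \<open>nu_basis\<close>. Labels turn sums over the
  list into double sums.\<close>

definition nu_index :: "nat list \<Rightarrow> (nat \<times> nat) list" where
  "nu_index s = concat (map (\<lambda>l. map (Pair l) (rev [0..<weight s l])) [0..<length s])"

lemma nu_basis_eq:
  "nu_basis s = map (\<lambda>(l, j). t_minus_theta ^ j \<cdot>\<^sub>v basis_m s l) (nu_index s)"
  by (simp add: nu_basis_def nu_index_def map_concat comp_def)

lemma length_nu_index [simp]: "length (nu_index s) = dimE s"
  by (simp add: nu_index_def dimE_def length_concat comp_def interv_sum_list_conv_sum_set_nat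
      atLeast0LessThan)

lemma set_nu_index: "set (nu_index s) = (SIGMA l:{..<length s}. {..<weight s l})"
  by (auto simp: nu_index_def)

lemma distinct_nu_index: "distinct (nu_index s)"
  by (rule card_distinct) (simp add: set_nu_index card_SigmaI dimE_def)

lemma bij_betw_nu_index:
  "bij_betw (\<lambda>i. nu_index s ! i) {..<dimE s} (SIGMA l:{..<length s}. {..<weight s l})"
  by (rule bij_betw_nth) (simp_all add: distinct_nu_index set_nu_index)

lemma nu_basis_index:
  assumes "i < dimE s" "l < length s"
  shows "nu_basis s ! i $ l =
           (if fst (nu_index s ! i) = l then t_minus_theta ^ snd (nu_index s ! i) else 0)"
proof -
  have "nu_index s ! i \<in> (SIGMA l:{..<length s}. {..<weight s l})"
    using bij_betw_nu_index assms(1) by (metis bij_betwE lessThan_iff)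
  then show ?thesis
    using assms by (auto simp: nu_basis_eq split: prod.splits)
qed

lemma dim_nu_basis [simp]: "i < dimE s \<Longrightarrow> dim_vec (nu_basis s ! i) = length s"
  by (simp add: nu_basis_eq split: prod.splits)

definition nu_comb :: "nat list \<Rightarrow> (nat \<Rightarrow> 'a::finite_field kbar) \<Rightarrow> 'a kbar poly vec" where
  "nu_comb s c = vec (length s) (\<lambda>l. \<Sum>i<dimE s. smult (c i) (nu_basis s ! i $ l))"

lemma nu_comb_carrier [simp]: "nu_comb s c \<in> carrier_vec (length s)"
  and dim_nu_comb [simp]: "dim_vec (nu_comb s c) = length s"
  by (simp_all add: nu_comb_def)

text \<open>The function \<open>b\<close> carries the coefficients from list positions to labels.
  Each row then has the shape of a truncated Taylor expansion in t - theta.\<close>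

lemma nu_comb_index:
  assumes "l < length s" and "\<And>i. i < dimE s \<Longrightarrow> c i = b (nu_index s ! i)"
  shows "nu_comb s c $ l = (\<Sum>j<weight s l. smult (b (l, j)) (t_minus_theta ^ j))"
proof -
  have "nu_comb s c $ l = (\<Sum>i<dimE s. (\<lambda>(m, j). if m = l then smult (b (m, j)) (t_minus_theta ^ j) else 0)
          (nu_index s ! i))"
    using assms by (auto simp: nu_comb_def nu_basis_index split: prod.splits intro!: sum.cong)
  also have "\<dots> = (\<Sum>(m, j)\<in>(SIGMA l:{..<length s}. {..<weight s l}).
      if m = l then smult (b (m, j)) (t_minus_theta ^ j) else 0)"
    by (rule sum.reindex_bij_betw[OF bij_betw_nu_index])
  also have "\<dots> = (\<Sum>m<length s. \<Sum>j<weight s m. if m = l then smult (b (m, j)) (t_minus_theta ^ j) else 0)"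
    by (rule sum.Sigma[symmetric]) auto
  also have "\<dots> = (\<Sum>m<length s. if m = l then \<Sum>j<weight s m. smult (b (m, j)) (t_minus_theta ^ j) else 0)"
    by (rule sum.cong) auto
  finally show ?thesis
    using assms(1) by simp
qed

section \<open>Division by sigma with remainder\<close>

definition low_coord :: "nat list \<Rightarrow> 'a::finite_field kbar poly vec \<Rightarrow> nat \<Rightarrow> 'a kbar" where
  "low_coord s f i = coeff (taylor (f $ fst (nu_index s ! i))) (snd (nu_index s ! i))"

text \<open>The quotient map S, whose remainder c is \<open>low_coord\<close>. The factors of sigma
  are undone in reverse order: first the powers of t - theta, then the inverse twist, then the
  unipotent matrix.\<close>

definition sigma_quot :: "nat list \<Rightarrow> 'a::finite_field kbar poly vec \<Rightarrow> 'a kbar poly vec" where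
  "sigma_quot s f =
     unipotent_inv s (vec (length s) (\<lambda>k. twist (taylor_quot (weight s k) (f $ k))))"

lemma dim_sigma_quot [simp]: "dim_vec (sigma_quot s h) = length s"
  by (simp add: sigma_quot_def)

lemma sigma_quot_index:
  "j < length s \<Longrightarrow> sigma_quot s f $ j =
     (\<Sum>k\<in>{j..<length s}. (\<Prod>i\<in>{j..<k}. - H_poly s i) * twist (taylor_quot (weight s k) (f $ k)))"
  by (simp add: sigma_quot_def unipotent_inv_def)

text \<open>In row \<open>l\<close> this is the Taylor expansion cut at \<open>weight s l\<close>:
  the terms below come from nu, the rest is the image under sigma.\<close>

lemma sigma_decomposition:
  assumes "dim_vec f = length s"
  shows "f = nu_comb s (low_coord s f) + sigma s (sigma_quot s f)"
proof (rule eq_vecI)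
  fix l assume "l < dim_vec (nu_comb s (low_coord s f) + sigma s (sigma_quot s f))"
  then have l: "l < length s"
    by simp
  have "nu_comb s (low_coord s f) $ l
      = (\<Sum>j<weight s l. smult (coeff (taylor (f $ l)) j) (t_minus_theta ^ j))"
    using nu_comb_index[OF l, of "low_coord s f" "\<lambda>(m, j). coeff (taylor (f $ m)) j"]
    by (simp add: low_coord_def split_beta)
  moreover have "sigma s (sigma_quot s f) $ l = t_minus_theta ^ weight s l * taylor_quot (weight s l) (f $ l)"
    unfolding sigma_index[OF l] sigma_quot_def unipotent_inv_rec[OF l] using l by simp
  ultimately show "f $ l = (nu_comb s (low_coord s f) + sigma s (sigma_quot s f)) $ l"
    using l taylor_expansion[of "f $ l" "weight s l"] by simp
qed (use assms in simp)

text \<open>Every row is a Taylor expansion whose two parts are unique. In particular sigma is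
  injective, and its image meets the span of nu only in 0.\<close>

lemma sigma_decomposition_unique:
  assumes "dim_vec g = length s"
  shows "i < dimE s \<Longrightarrow> low_coord s (nu_comb s c + sigma s g) i = c i"
    and "sigma_quot s (nu_comb s c + sigma s g) = g"
proof -
  define f where "f = nu_comb s c + sigma s g"
  \<comment> \<open>Inverting the enumeration of labels turns \<open>c\<close> into a function of
    labels, as \<open>nu_comb_index\<close> requires.\<close>
  define b where "b = (\<lambda>p. c (the_inv_into {..<dimE s} (\<lambda>i. nu_index s ! i) p))"
  have inj: "inj_on (\<lambda>i. nu_index s ! i) {..<dimE s}"
    using bij_betw_nu_index by (rule bij_betw_imp_inj_on)
  have c: "c i = b (nu_index s ! i)" if "i < dimE s" for i
    using that by (simp add: b_def the_inv_into_f_f[OF inj])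
  define u where "u = (\<lambda>l. g $ l + (if Suc l < length s then H_poly s l * g $ Suc l else 0))"
  have f: "f $ l = (\<Sum>j<weight s l. smult (b (l, j)) (t_minus_theta ^ j))
                     + t_minus_theta ^ weight s l * inv_twist (u l)" if "l < length s" for l
    using that by (simp add: f_def sigma_index u_def nu_comb_index[OF that, of c b, OF c])
  show "low_coord s (nu_comb s c + sigma s g) i = c i" if "i < dimE s"
  proof -
    have "nu_index s ! i \<in> (SIGMA l:{..<length s}. {..<weight s l})"
      using bij_betw_nu_index that by (metis bij_betwE lessThan_iff)
    then show ?thesis
      unfolding low_coord_def f_def[symmetric] c[OF that]
      by (auto simp: taylor_expansion_unique(1)[OF f])
  qed
  show "sigma_quot s (nu_comb s c + sigma s g) = g"
    unfolding sigma_quot_def f_def[symmetric]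
    by (rule unipotent_inv_unique) (auto simp: assms taylor_expansion_unique(2)[OF f] u_def)
qed

lemma low_coord_add:
  "dim_vec f = length s \<Longrightarrow> dim_vec g = length s \<Longrightarrow> i < dimE s \<Longrightarrow>
     low_coord s (f + g) i = low_coord s f i + low_coord s g i"
  using bij_betwE[OF bij_betw_nu_index[of s], rule_format, of i]
  by (auto simp: low_coord_def taylor.hom_add)

lemma low_coord_smult:
  "dim_vec f = length s \<Longrightarrow> i < dimE s \<Longrightarrow>
     low_coord s ([:x:] \<cdot>\<^sub>v f) i = x * low_coord s f i"
  using bij_betwE[OF bij_betw_nu_index[of s], rule_format, of i]
  by (auto simp: low_coord_def)

lemma sigma_quot_add:
  assumes "dim_vec f = length s" "dim_vec g = length s"
  shows "sigma_quot s (f + g) = sigma_quot s f + sigma_quot s g"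
proof (rule eq_vecI)
  fix j assume "j < dim_vec (sigma_quot s f + sigma_quot s g)"
  then have j: "j < length s"
    by simp
  have "sigma_quot s (f + g) $ j = (\<Sum>k\<in>{j..<length s}.
      (\<Prod>i\<in>{j..<k}. - H_poly s i) * twist (taylor_quot (weight s k) (f $ k))
        + (\<Prod>i\<in>{j..<k}. - H_poly s i) * twist (taylor_quot (weight s k) (g $ k)))"
    unfolding sigma_quot_index[OF j] using assms
    by (intro sum.cong refl) (simp add: taylor_quot_add twist.hom_add distrib_left)
  then show "sigma_quot s (f + g) $ j = (sigma_quot s f + sigma_quot s g) $ j"
    using j by (simp add: sum.distrib sigma_quot_index)
qed simp

lemma twist_smult: "twist (smult x p) = smult (x ^ CARD('a)) (twist (p :: 'a::finite_field kbar poly))"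
  by (rule poly_eqI) (simp add: power_mult_distrib)

text \<open>Of the factors of S only the twist is not linear over constants, and it raises them to
  the power q. This is where tau comes from.\<close>

lemma sigma_quot_smult:
  fixes f :: "'a::finite_field kbar poly vec"
  assumes "dim_vec f = length s"
  shows "sigma_quot s ([:x:] \<cdot>\<^sub>v f) = [:x ^ CARD('a):] \<cdot>\<^sub>v sigma_quot s f"
proof (rule eq_vecI)
  fix j assume "j < dim_vec ([:x ^ CARD('a):] \<cdot>\<^sub>v sigma_quot s f)"
  then have j: "j < length s"
    by simp
  have "sigma_quot s ([:x:] \<cdot>\<^sub>v f) $ j = (\<Sum>k\<in>{j..<length s}.
      smult (x ^ CARD('a)) ((\<Prod>i\<in>{j..<k}. - H_poly s i) * twist (taylor_quot (weight s k) (f $ k))))"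
    unfolding sigma_quot_index[OF j] using assms
    by (intro sum.cong refl) (simp add: taylor_quot_smult twist_smult)
  then show "sigma_quot s ([:x:] \<cdot>\<^sub>v f) $ j = ([:x ^ CARD('a):] \<cdot>\<^sub>v sigma_quot s f) $ j"
    using j by (simp add: smult_sum2 sigma_quot_index)
qed simp

lemma sigma_quot_zero [simp]: "sigma_quot s (0\<^sub>v (length s)) = 0\<^sub>v (length s)"
  by (rule eq_vecI) (auto simp: sigma_quot_index)

section \<open>Nilpotence of the quotient map\<close>

lemma sigma_quot_funpow_dim [simp]:
  "dim_vec f = length s \<Longrightarrow> dim_vec ((sigma_quot s ^^ k) f) = length s"
  by (cases k) simp_all

lemma sigma_quot_funpow_zero:
  assumes "(sigma_quot s ^^ k) f = 0\<^sub>v (length s)" "k \<le> n"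
  shows "(sigma_quot s ^^ n) f = 0\<^sub>v (length s)"
proof -
  have "(sigma_quot s ^^ m) (0\<^sub>v (length s)) = 0\<^sub>v (length s)" for m
    by (induction m) auto
  moreover have "(sigma_quot s ^^ n) f = (sigma_quot s ^^ (n - k)) ((sigma_quot s ^^ k) f)"
    using assms(2) by (simp flip: funpow_add[THEN fun_cong, unfolded comp_apply])
  ultimately show ?thesis
    by (simp add: assms(1))
qed

text \<open>The last nonzero component of \<open>f\<close> loses degree until it vanishes, while the earlier
  components may grow in between.\<close>

lemma sigma_quot_nilpotent:
  assumes "\<forall>n\<in>set s. 0 < n" and "dim_vec f = length s"
  obtains k where "(sigma_quot s ^^ k) f = 0\<^sub>v (length s)"
proof -
  \<comment> \<open>The number \<open>m\<close> bounds the support: all components from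
    \<open>m\<close> on vanish. The outer induction is on \<open>m\<close>, the inner one on the
    length of the last component that may be nonzero.\<close>
  have "\<exists>k. (sigma_quot s ^^ k) f = 0\<^sub>v (length s)"
    if "m \<le> length s" "dim_vec f = length s" "\<And>j. m \<le> j \<Longrightarrow> j < length s \<Longrightarrow> f $ j = 0" for m f
    using that
  proof (induction m arbitrary: f)
    case 0
    then have "f = 0\<^sub>v (length s)"
      by (intro eq_vecI) auto
    then show ?case
      by (auto intro: exI[of _ 0])
  next
    case (Suc m)
    \<comment> \<open>Positive entries of \<open>s\<close> give positive weights, so that each
      division really lowers the degree.\<close>
    have "s ! m \<in> set (drop m s)"
      using Suc.prems(1) by (metis Cons_nth_drop_Suc Suc_le_eq list.set_intros(1))
    then have "s ! m \<le> weight s m"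
      unfolding weight_def by (simp add: member_le_sum_list)
    moreover have "0 < s ! m"
      using Suc.prems(1) assms(1) by simp
    ultimately have w: "0 < weight s m"
      by simp
    show ?case
      using Suc.prems
    proof (induction "length (coeffs (f $ m))" arbitrary: f rule: less_induct)
      case less
      show ?case
      proof (cases "f $ m = 0")
        case True
        then have "f $ j = 0" if "m \<le> j" "j < length s" for j
          using less.prems(3)[of j] that by (cases "j = m") auto
        then show ?thesis
          using less.prems(1,2) by (intro Suc.IH) auto
      next
        case False
        \<comment> \<open>Beyond \<open>m\<close> nothing is left to sum, and in row
          \<open>m\<close> the unipotent factor acts as the identity. So S only divides and twists
          component \<open>m\<close>.\<close>
        have 0: "sigma_quot s f $ j = (if j = m then twist (taylor_quot (weight s m) (f $ m)) else 0)"
          if "m \<le> j" "j < length s" for j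
        proof -
          have "f $ k = 0" if "m < k" "k < length s" for k
            using less.prems(3)[of k] that by simp
          then have *: "(\<Prod>i\<in>{j..<k}. - H_poly s i) * twist (taylor_quot (weight s k) (f $ k))
              = (if k = m then twist (taylor_quot (weight s m) (f $ m)) else 0)"
            if "k \<in> {j..<length s}" for k
            using that \<open>m \<le> j\<close> by auto
          have "sigma_quot s f $ j = (\<Sum>k\<in>{j..<length s}. if k = m then twist (taylor_quot (weight s m) (f $ m)) else 0)"
            unfolding sigma_quot_index[OF that(2)] using *
            by (intro sum.cong) auto
          then show ?thesis
            using that by auto
        qed
        have "length (coeffs (sigma_quot s f $ m)) < length (coeffs (f $ m))"
          using 0[of m] less.prems(1) w False by (simp add: length_coeffs_taylor_quot)
        then obtain k where "(sigma_quot s ^^ k) (sigma_quot s f) = 0\<^sub>v (length s)"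
          using less.hyps[of "sigma_quot s f"] less.prems(1) 0 by auto
        then show ?thesis
          by (metis comp_apply funpow_Suc_right)
      qed
    qed
  qed
  from this[of "length s" f] show ?thesis
    using assms(2) that by auto
qed

subsection \<open>Coordinates with respect to nu\<close>

text \<open>Allows sums bounded by the degree, as in \<open>sigma_act\<close>, \<open>delta\<close>
  and \<open>tau_eval\<close>, to be compared over a common range of indices.\<close>

lemma sum_coeff_up_to:
  assumes "\<And>i. F i 0 = 0" and "\<And>i. n \<le> i \<Longrightarrow> coeff u i = 0"
  shows "(\<Sum>i\<le>degree u. F i (coeff u i)) = (\<Sum>i<n. F i (coeff u i))"
proof -
  have "(\<Sum>i\<le>degree u. F i (coeff u i)) = (\<Sum>i<max n (Suc (degree u)). F i (coeff u i))"
    using assms(1) by (intro sum.mono_neutral_left) (auto simp: coeff_eq_0)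
  also have "\<dots> = (\<Sum>i<n. F i (coeff u i))"
    using assms by (intro sum.mono_neutral_right) auto
  finally show ?thesis .
qed

lemma sigma_funpow_dim [simp]: "dim_vec f = length s \<Longrightarrow> dim_vec ((sigma s ^^ k) f) = length s"
  by (cases k) simp_all

lemma dim_sigma_act [simp]: "dim_vec (sigma_act s u f) = length s"
  by (simp add: sigma_act_def)

text \<open>In the twisted ring \<open>pCons c (inv_twist u)\<close> represents c + sigma u, because
  moving sigma past a coefficient takes its q-th root.\<close>

lemma sigma_act_pCons:
  assumes "dim_vec f = length s"
  shows "sigma_act s (pCons c (inv_twist u)) f = [:c:] \<cdot>\<^sub>v f + sigma s (sigma_act s u f)"
proof (rule eq_vecI)
  fix j assume "j < dim_vec ([:c:] \<cdot>\<^sub>v f + sigma s (sigma_act s u f))"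
  then have j: "j < length s"
    by simp
  define n where "n = Suc (degree u)"
  have n: "coeff u i = 0" if "n \<le> i" for i
    using that by (simp add: n_def coeff_eq_0)
  have n': "coeff (pCons c (inv_twist u)) i = 0" if "Suc n \<le> i" for i
    using that n by (auto simp: coeff_pCons split: nat.splits)
  have "sigma_act s (pCons c (inv_twist u)) f $ j
      = (\<Sum>i<Suc n. smult (coeff (pCons c (inv_twist u)) i) ((sigma s ^^ i) f $ j))"
    using j unfolding sigma_act_def
    by (simp only: index_vec) (rule sum_coeff_up_to, auto simp: n')
  also have "\<dots> = smult c (f $ j) + (\<Sum>i<n. smult (qth_root (coeff u i)) ((sigma s ^^ Suc i) f $ j))"
    unfolding sum.lessThan_Suc_shift by simp
  also have "(\<Sum>i<n. smult (qth_root (coeff u i)) ((sigma s ^^ Suc i) f $ j))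
      = (\<Sum>i<n. sigma s ([:coeff u i:] \<cdot>\<^sub>v (sigma s ^^ i) f) $ j)"
    using j assms by (simp add: sigma_smult)
  also have "\<dots> = sigma s (vec (length s) (\<lambda>k. \<Sum>i<n. ([:coeff u i:] \<cdot>\<^sub>v (sigma s ^^ i) f) $ k)) $ j"
    by (rule sigma_sum_index[symmetric]) (use j assms in auto)
  also have "vec (length s) (\<lambda>k. \<Sum>i<n. ([:coeff u i:] \<cdot>\<^sub>v (sigma s ^^ i) f) $ k) = sigma_act s u f"
    unfolding sigma_act_def
  proof (intro eq_vecI)
    fix k assume "k < dim_vec (vec (length s) (\<lambda>j. \<Sum>i\<le>degree u. smult (coeff u i) ((sigma s ^^ i) f $ j)))"
    then show "vec (length s) (\<lambda>k. \<Sum>i<n. ([:coeff u i:] \<cdot>\<^sub>v (sigma s ^^ i) f) $ k) $ k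
        = vec (length s) (\<lambda>j. \<Sum>i\<le>degree u. smult (coeff u i) ((sigma s ^^ i) f $ j)) $ k"
      using assms by (simp add: n_def lessThan_Suc_atMost)
  qed simp
  finally show "sigma_act s (pCons c (inv_twist u)) f $ j
      = ([:c:] \<cdot>\<^sub>v f + sigma s (sigma_act s u f)) $ j"
    using j assms by simp
qed (use assms in simp)

text \<open>The map that \<open>nu_coords\<close> inverts.\<close>

definition nu_expand :: "nat list \<Rightarrow> 'a::finite_field twisted_poly vec \<Rightarrow> 'a kbar poly vec" where
  "nu_expand s u = vec (length s) (\<lambda>j. \<Sum>i<dimE s. sigma_act s (u $ i) (nu_basis s ! i) $ j)"

lemma dim_nu_expand [simp]: "dim_vec (nu_expand s u) = length s"
  by (simp add: nu_expand_def)

lemma nu_expand_pCons: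
  assumes "\<And>i. i < dimE s \<Longrightarrow> u $ i = pCons (c i) (inv_twist (v $ i))"
  shows "nu_expand s u = nu_comb s c + sigma s (nu_expand s v)"
proof (rule eq_vecI)
  fix j assume "j < dim_vec (nu_comb s c + sigma s (nu_expand s v))"
  then have j: "j < length s"
    by simp
  have "nu_expand s u $ j = (\<Sum>i<dimE s. smult (c i) (nu_basis s ! i $ j)
          + sigma s (sigma_act s (v $ i) (nu_basis s ! i)) $ j)"
    using j by (simp add: nu_expand_def assms sigma_act_pCons)
  also have "\<dots> = nu_comb s c $ j + (\<Sum>i<dimE s. sigma s (sigma_act s (v $ i) (nu_basis s ! i)) $ j)"
    using j by (simp add: sum.distrib nu_comb_def)
  also have "(\<Sum>i<dimE s. sigma s (sigma_act s (v $ i) (nu_basis s ! i)) $ j) = sigma s (nu_expand s v) $ j"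
    unfolding nu_expand_def by (rule sigma_sum_index[symmetric]) (use j in auto)
  finally show "nu_expand s u $ j = (nu_comb s c + sigma s (nu_expand s v)) $ j"
    using j by simp
qed simp

lemma nu_expand_zero [simp]: "nu_expand s (0\<^sub>v (dimE s)) = 0\<^sub>v (length s)"
  by (rule eq_vecI) (auto simp: nu_expand_def sigma_act_def)

text \<open>The value determines the constant terms of the coordinates as its remainder, and its
  quotient is the value at the shifted coordinates. Induction on a common length bound peels off one
  sigma at a time.\<close>

lemma nu_expand_inj:
  fixes u v :: "'a::finite_field twisted_poly vec"
  assumes "u \<in> carrier_vec (dimE s)" "v \<in> carrier_vec (dimE s)" "nu_expand s u = nu_expand s v"
  shows "u = v"
proof -
  have "u = v"
    if "u \<in> carrier_vec (dimE s)" "v \<in> carrier_vec (dimE s)" "nu_expand s u = nu_expand s v"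
      "\<And>i. i < dimE s \<Longrightarrow> length (coeffs (u $ i)) \<le> n \<and> length (coeffs (v $ i)) \<le> n" for n and u v :: "'a twisted_poly vec"
    using that
  proof (induction n arbitrary: u v)
    case 0
    then show ?case
      by (intro eq_vecI) auto
  next
    case (Suc n)
    \<comment> \<open>Passes from c + sigma w to w in each coordinate; the twist undoes the q-th
      roots produced by sigma.\<close>
    define shift :: "'a twisted_poly vec \<Rightarrow> 'a twisted_poly vec"
      where "shift w = map_vec (\<lambda>p. twist (poly_shift 1 p)) w" for w
    have eq: "pCons (coeff p 0) (poly_shift 1 p) = p" for p :: "'a kbar poly"
      by (rule poly_eqI) (auto simp: coeff_pCons coeff_poly_shift split: nat.splits)
    have dec: "nu_expand s w = nu_comb s (\<lambda>i. coeff (w $ i) 0) + sigma s (nu_expand s (shift w))"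
      if "w \<in> carrier_vec (dimE s)" for w
      using that by (intro nu_expand_pCons) (simp add: shift_def eq del: One_nat_def)
    have quot: "nu_expand s (shift w) = sigma_quot s (nu_expand s w)"
      and low: "i < dimE s \<Longrightarrow> coeff (w $ i) 0 = low_coord s (nu_expand s w) i"
      if "w \<in> carrier_vec (dimE s)" for w i
      unfolding dec[OF that] by (simp_all add: sigma_decomposition_unique)
    have shift: "shift u = shift v"
    proof (rule Suc.IH)
      show "nu_expand s (shift u) = nu_expand s (shift v)"
        unfolding quot[OF Suc.prems(1)] quot[OF Suc.prems(2)] Suc.prems(3) ..
      show "length (coeffs (shift u $ i)) \<le> n \<and> length (coeffs (shift v $ i)) \<le> n" if "i < dimE s" for i
        using Suc.prems(1,2) Suc.prems(4)[OF that] that by (auto simp: shift_def coeffs_shift_poly)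
    qed (use Suc.prems in \<open>auto simp: shift_def\<close>)
    have "coeff (u $ i) 0 = coeff (v $ i) 0" if "i < dimE s" for i
      unfolding low[OF Suc.prems(1) that] low[OF Suc.prems(2) that] Suc.prems(3) ..
    moreover have "poly_shift 1 (u $ i) = poly_shift 1 (v $ i)" if "i < dimE s" for i
      using arg_cong[OF shift, of "\<lambda>w. inv_twist (w $ i)"] Suc.prems(1,2) that by (simp add: shift_def)
    ultimately have "u $ i = v $ i" if "i < dimE s" for i
      using that eq[of "u $ i"] eq[of "v $ i"] by simp
    then show ?case
      using Suc.prems(1,2) by (intro eq_vecI) auto
  qed
  moreover define n where "n = Max (insert 0 ((\<lambda>i. max (length (coeffs (u $ i))) (length (coeffs (v $ i)))) ` {..<dimE s}))"
  have "length (coeffs (u $ i)) \<le> n \<and> length (coeffs (v $ i)) \<le> n" if "i < dimE s" for i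
  proof -
    have "max (length (coeffs (u $ i))) (length (coeffs (v $ i))) \<le> n"
      unfolding n_def using that by (intro Max_ge insertI2 image_eqI[where x = i]) simp_all
    then show ?thesis
      by simp
  qed
  ultimately show ?thesis
    using assms by blast
qed

lemma nu_coords_expand:
  assumes "u \<in> carrier_vec (dimE s)"
  shows "nu_coords s (nu_expand s u) = u"
  unfolding nu_coords_def nu_expand_def[symmetric]
  by (rule the_equality) (use assms in \<open>auto dest: nu_expand_inj\<close>)

text \<open>Coordinates of \<open>f\<close> arise from those of \<open>sigma_quot s f\<close> by
  putting \<open>low_coord s f\<close> in front. Nilpotence lets the recursion start at 0.\<close>

lemma nu_expand_surj:
  fixes f :: "'a::finite_field kbar poly vec"
  assumes "\<forall>n\<in>set s. 0 < n" "dim_vec f = length s"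
  obtains u where "u \<in> carrier_vec (dimE s)" "f = nu_expand s u"
proof -
  obtain k where "(sigma_quot s ^^ k) f = 0\<^sub>v (length s)"
    using assms by (rule sigma_quot_nilpotent)
  then have "\<exists>u\<in>carrier_vec (dimE s). f = nu_expand s u"
    using assms(2)
  proof (induction k arbitrary: f)
    case 0
    then show ?case
      by (intro bexI[of _ "0\<^sub>v (dimE s)"]) auto
  next
    case (Suc k)
    have "(sigma_quot s ^^ k) (sigma_quot s f) = 0\<^sub>v (length s)"
      using Suc.prems(1) by (simp add: funpow_swap1)
    then obtain v where v: "v \<in> carrier_vec (dimE s)" "sigma_quot s f = nu_expand s v"
      using Suc.IH[of "sigma_quot s f"] by auto
    have "f = nu_expand s (vec (dimE s) (\<lambda>i. pCons (low_coord s f i) (inv_twist (v $ i))))"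
      using sigma_decomposition[OF Suc.prems(2)] unfolding v(2)
      by (subst nu_expand_pCons[where c = "low_coord s f" and v = v]) auto
    then show ?case
      by (metis vec_carrier)
  qed
  then show ?thesis
    using that by blast
qed

section \<open>The map Delta\<close>

text \<open>The q-th root of each coefficient cancels against the exponent of its new position, so
  \<open>delta\<close> does not see multiplication by sigma from the left.\<close>

lemma delta_pCons: "delta (pCons c (inv_twist (u :: 'a::finite_field twisted_poly))) = c + delta u"
proof -
  define n where "n = Suc (degree u)"
  have n: "coeff u i = 0" if "n \<le> i" for i
    using that by (simp add: n_def coeff_eq_0)
  have n': "coeff (pCons c (inv_twist u)) i = 0" if "Suc n \<le> i" for i
    using that n by (auto simp: coeff_pCons split: nat.splits)
  have "delta (pCons c (inv_twist u)) = (\<Sum>i<Suc n. coeff (pCons c (inv_twist u)) i ^ CARD('a) ^ i)"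
    unfolding delta_def by (rule sum_coeff_up_to) (simp_all add: n')
  also have "\<dots> = c + (\<Sum>i<n. coeff u i ^ CARD('a) ^ i)"
    unfolding sum.lessThan_Suc_shift by (simp add: power_mult)
  finally show ?thesis
    by (simp add: delta_def n_def lessThan_Suc_atMost)
qed

text \<open>Since \<open>nu_coords\<close> is a definite description, even the dimension of the
  result rests on existence and uniqueness of coordinates.\<close>

lemma Delta_carrier:
  assumes "\<forall>n\<in>set s. 0 < n" "dim_vec f = length s"
  shows "Delta s f \<in> carrier_vec (dimE s)"
proof -
  obtain u where "u \<in> carrier_vec (dimE s)" "f = nu_expand s u"
    using nu_expand_surj[OF assms] .
  then show ?thesis
    by (simp add: Delta_def nu_coords_expand)
qed

lemma dim_Delta:
  "\<forall>n\<in>set s. 0 < n \<Longrightarrow> dim_vec f = length s \<Longrightarrow> dim_vec (Delta s f) = dimE s"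
  using Delta_carrier by (rule carrier_vecD)

text \<open>The coordinates of \<open>f\<close> are c(f) + sigma v with v those of S f, and
  \<open>delta\<close> ignores this sigma.\<close>

lemma Delta_step:
  assumes "\<forall>n\<in>set s. 0 < n" "dim_vec f = length s" "i < dimE s"
  shows "Delta s f $ i = low_coord s f i + Delta s (sigma_quot s f) $ i"
proof -
  obtain v where v: "v \<in> carrier_vec (dimE s)" "sigma_quot s f = nu_expand s v"
    using nu_expand_surj[OF assms(1) dim_sigma_quot] .
  define u where "u = vec (dimE s) (\<lambda>i. pCons (low_coord s f i) (inv_twist (v $ i)))"
  have "f = nu_expand s u"
    using sigma_decomposition[OF assms(2)] unfolding v(2) u_def
    by (subst nu_expand_pCons[where c = "low_coord s f" and v = v]) auto
  then have "Delta s f $ i = delta (u $ i)"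
    using assms(3) nu_coords_expand[of u s] by (simp add: Delta_def u_def)
  also have "\<dots> = low_coord s f i + delta (v $ i)"
    using assms(3) by (simp add: u_def delta_pCons)
  also have "delta (v $ i) = Delta s (sigma_quot s f) $ i"
    using assms(3) v by (simp add: Delta_def nu_coords_expand)
  finally show ?thesis .
qed

lemma Delta_zero: "Delta s (0\<^sub>v (length s)) = (0\<^sub>v (dimE s) :: 'a::finite_field kbar vec)"
proof -
  have "nu_coords s (0\<^sub>v (length s)) = (0\<^sub>v (dimE s) :: 'a twisted_poly vec)"
    using nu_coords_expand[of "0\<^sub>v (dimE s)" s] by simp
  then show ?thesis
    by (auto simp: Delta_def delta_def)
qed

text \<open>Iteration of \<open>Delta_step\<close>. Any \<open>n\<close> past the vanishing of the
  iterates is allowed, so several vectors can share one \<open>n\<close>.\<close>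

lemma Delta_eq_sum:
  assumes "\<forall>n\<in>set s. 0 < n" "dim_vec f = length s" "(sigma_quot s ^^ n) f = 0\<^sub>v (length s)" "i < dimE s"
  shows "Delta s f $ i = (\<Sum>k<n. low_coord s ((sigma_quot s ^^ k) f) i)"
  using assms(2,3)
proof (induction n arbitrary: f)
  case 0
  then show ?case
    using assms(4) by (simp add: Delta_zero)
next
  case (Suc n)
  have "Delta s (sigma_quot s f) $ i = (\<Sum>k<n. low_coord s ((sigma_quot s ^^ k) (sigma_quot s f)) i)"
    using Suc by (intro Suc.IH) (auto simp: funpow_swap1)
  then show ?case
    using Delta_step[OF assms(1) Suc.prems(1) assms(4)]
    unfolding sum.lessThan_Suc_shift by (simp add: funpow_swap1)
qed

lemma Delta_add:
  assumes "\<forall>n\<in>set s. 0 < n" "dim_vec f = length s" "dim_vec g = length s"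
  shows "Delta s (f + g) = Delta s f + Delta s g"
proof -
  obtain k l where kl: "(sigma_quot s ^^ k) f = 0\<^sub>v (length s)" "(sigma_quot s ^^ l) g = 0\<^sub>v (length s)"
    using sigma_quot_nilpotent assms by metis
  define n where "n = max k l"
  have n: "(sigma_quot s ^^ n) f = 0\<^sub>v (length s)" "(sigma_quot s ^^ n) g = 0\<^sub>v (length s)"
    unfolding n_def by (rule sigma_quot_funpow_zero[OF kl(1)] sigma_quot_funpow_zero[OF kl(2)], simp)+
  have add: "(sigma_quot s ^^ m) (f + g) = (sigma_quot s ^^ m) f + (sigma_quot s ^^ m) g" for m
    by (induction m) (simp_all add: sigma_quot_add assms)
  show ?thesis
  proof (rule eq_vecI)
    fix i assume "i < dim_vec (Delta s f + Delta s g)"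
    then have i: "i < dimE s"
      using Delta_carrier[OF assms(1,3)] by simp
    have "(sigma_quot s ^^ n) (f + g) = 0\<^sub>v (length s)"
      by (simp add: add n)
    from Delta_eq_sum[OF assms(1) _ this i] show "Delta s (f + g) $ i = (Delta s f + Delta s g) $ i"
      using i Delta_carrier[OF assms(1,3)] assms
      by (simp add: Delta_eq_sum[OF _ _ n(1)] Delta_eq_sum[OF _ _ n(2)] add low_coord_add sum.distrib)
  qed (use assms in \<open>simp add: dim_Delta\<close>)
qed

text \<open>The vector \<open>sigma s g\<close> has remainder 0 and quotient \<open>g\<close>. So
  Delta kills the image of sigma - 1.\<close>

lemma Delta_sigma:
  fixes g :: "'a::finite_field kbar poly vec"
  assumes "\<forall>n\<in>set s. 0 < n" "dim_vec g = length s"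
  shows "Delta s (sigma s g) = Delta s g"
proof (rule eq_vecI)
  fix i assume "i < dim_vec (Delta s g)"
  then have i: "i < dimE s"
    using Delta_carrier[OF assms] by simp
  have *: "nu_comb s (\<lambda>_. 0) + sigma s g = sigma s g"
    by (rule eq_vecI) (auto simp: nu_comb_def)
  show "Delta s (sigma s g) $ i = Delta s g $ i"
    using sigma_decomposition_unique(1)[OF assms(2) i, of "\<lambda>_. 0"]
      sigma_decomposition_unique(2)[OF assms(2), of "\<lambda>_. 0"]
    unfolding * by (subst Delta_step[OF assms(1) _ i]) auto
qed (use assms in \<open>simp add: dim_Delta\<close>)

text \<open>Here the quotient is 0 and the remainder is \<open>c\<close>. This yields the
  surjectivity of Delta.\<close>

lemma Delta_nu_comb:
  fixes c :: "nat \<Rightarrow> 'a::finite_field kbar"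
  assumes "\<forall>n\<in>set s. 0 < n"
  shows "Delta s (nu_comb s c) = vec (dimE s) c"
proof (rule eq_vecI)
  fix i assume "i < dim_vec (vec (dimE s) c)"
  then have i: "i < dimE s"
    by simp
  have *: "nu_comb s c + sigma s (0\<^sub>v (length s)) = nu_comb s c"
    by (rule eq_vecI) auto
  have 0: "dim_vec (0\<^sub>v (length s) :: 'a kbar poly vec) = length s"
    by simp
  show "Delta s (nu_comb s c) $ i = vec (dimE s) c $ i"
    using sigma_decomposition_unique(1)[OF 0 i, of c] sigma_decomposition_unique(2)[OF 0, of c]
    unfolding * by (subst Delta_step[OF assms(1) _ i]) (auto simp: Delta_zero i)
qed (use assms in \<open>simp add: dim_Delta\<close>)

subsection \<open>Integrality\<close>

definition integral_poly :: "'a::finite_field kbar poly \<Rightarrow> bool" where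
  "integral_poly p \<longleftrightarrow> (\<forall>n. coeff p n \<in> range A_to_kbar)"

lemma range_A_to_kbar_closed:
  shows "0 \<in> range A_to_kbar" "1 \<in> range A_to_kbar"
    and "x \<in> range A_to_kbar \<Longrightarrow> y \<in> range A_to_kbar \<Longrightarrow> x + y \<in> range A_to_kbar"
    and "x \<in> range A_to_kbar \<Longrightarrow> y \<in> range A_to_kbar \<Longrightarrow> x * y \<in> range A_to_kbar"
    and "x \<in> range A_to_kbar \<Longrightarrow> - x \<in> range A_to_kbar"
    and "x \<in> range A_to_kbar \<Longrightarrow> x ^ n \<in> range A_to_kbar"
  by (auto simp flip: A_to_kbar.hom_zero A_to_kbar.hom_one A_to_kbar.hom_add A_to_kbar.hom_mult
      A_to_kbar.hom_uminus A_to_kbar.hom_power)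

lemma range_A_to_kbar_sum:
  "(\<And>i. i \<in> I \<Longrightarrow> f i \<in> range A_to_kbar) \<Longrightarrow> sum f I \<in> range A_to_kbar"
  by (induction I rule: infinite_finite_induct) (auto intro: range_A_to_kbar_closed)

lemma integral_poly_add: "integral_poly p \<Longrightarrow> integral_poly r \<Longrightarrow> integral_poly (p + r)"
  and integral_poly_uminus: "integral_poly p \<Longrightarrow> integral_poly (- p)"
  by (simp_all add: integral_poly_def range_A_to_kbar_closed)

lemma integral_poly_mult: "integral_poly p \<Longrightarrow> integral_poly r \<Longrightarrow> integral_poly (p * r)"
  unfolding integral_poly_def
  by (blast intro: coeff_mult_semiring_closed range_A_to_kbar_closed)

lemma integral_poly_pcompose: "integral_poly p \<Longrightarrow> integral_poly r \<Longrightarrow> integral_poly (p \<circ>\<^sub>p r)"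
  unfolding integral_poly_def
  by (blast intro: coeff_pcompose_semiring_closed range_A_to_kbar_closed)

lemma integral_poly_0: "integral_poly 0"
  by (simp add: integral_poly_def range_A_to_kbar_closed)

lemma integral_poly_pCons:
  "x \<in> range A_to_kbar \<Longrightarrow> integral_poly p \<Longrightarrow> integral_poly (pCons x p)"
  by (auto simp: integral_poly_def coeff_pCons split: nat.splits)

lemma integral_poly_1: "integral_poly 1"
  unfolding one_pCons by (intro integral_poly_pCons integral_poly_0 range_A_to_kbar_closed)

lemma integral_poly_sum: "(\<And>i. i \<in> I \<Longrightarrow> integral_poly (f i)) \<Longrightarrow> integral_poly (sum f I)"
  by (induction I rule: infinite_finite_induct) (auto intro: integral_poly_0 integral_poly_add)

lemma integral_poly_prod: "(\<And>i. i \<in> I \<Longrightarrow> integral_poly (f i)) \<Longrightarrow> integral_poly (prod f I)"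
  by (induction I rule: infinite_finite_induct) (auto intro: integral_poly_1 integral_poly_mult)

lemma integral_poly_power: "integral_poly p \<Longrightarrow> integral_poly (p ^ n)"
  by (induction n) (auto intro: integral_poly_1 integral_poly_mult)

lemma integral_poly_twist: "integral_poly p \<Longrightarrow> integral_poly (twist p)"
  by (simp add: integral_poly_def range_A_to_kbar_closed)

lemma integral_poly_taylor: "integral_poly p \<Longrightarrow> integral_poly (taylor p)"
  unfolding taylor_def
  by (intro integral_poly_pcompose integral_poly_pCons integral_poly_0)
    (auto simp: range_A_to_kbar_closed)

lemma integral_poly_t_minus_theta: "integral_poly t_minus_theta"
  unfolding t_minus_theta_eq
  by (intro integral_poly_pCons integral_poly_0) (auto simp: range_A_to_kbar_closed)

text \<open>The polynomial t - theta is monic with coefficients in A, so division by its powers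
  creates no denominators.\<close>

lemma integral_poly_taylor_quot: "integral_poly p \<Longrightarrow> integral_poly (taylor_quot w p)"
  unfolding taylor_quot_def
  by (intro integral_poly_pcompose integral_poly_t_minus_theta)
    (use integral_poly_taylor in \<open>auto simp: integral_poly_def coeff_poly_shift\<close>)

lemma integral_poly_H_poly: "integral_poly (H_poly s j)"
  by (simp add: integral_poly_def H_poly_def At_to_kbart_def)

definition integral_vec :: "'a::finite_field kbar poly vec \<Rightarrow> bool" where
  "integral_vec f \<longleftrightarrow> (\<forall>j<dim_vec f. integral_poly (f $ j))"

lemma integral_unipotent_inv:
  assumes "integral_vec h" "dim_vec h = length s"
  shows "integral_vec (unipotent_inv s h)"
  using assms unfolding integral_vec_def
  by (auto simp: unipotent_inv_def intro!: integral_poly_sum integral_poly_mult integral_poly_prod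
      integral_poly_uminus integral_poly_H_poly)

lemma integral_sigma_quot:
  assumes "integral_vec f" "dim_vec f = length s"
  shows "integral_vec (sigma_quot s f)"
  unfolding sigma_quot_def
  by (rule integral_unipotent_inv)
    (use assms in \<open>auto simp: integral_vec_def intro!: integral_poly_twist integral_poly_taylor_quot\<close>)

lemma integral_sigma_quot_funpow:
  assumes "integral_vec f" "dim_vec f = length s"
  shows "integral_vec ((sigma_quot s ^^ k) f)"
  using assms by (induction k) (auto intro: integral_sigma_quot)

lemma integral_low_coord:
  assumes "integral_vec f" "dim_vec f = length s" "i < dimE s"
  shows "low_coord s f i \<in> range A_to_kbar"
proof -
  have "nu_index s ! i \<in> (SIGMA l:{..<length s}. {..<weight s l})"
    using bij_betw_nu_index assms(3) by (metis bij_betwE lessThan_iff)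
  then have "integral_poly (taylor (f $ fst (nu_index s ! i)))"
    using assms(1,2) by (auto simp: integral_vec_def intro!: integral_poly_taylor)
  then show ?thesis
    by (simp add: low_coord_def integral_poly_def)
qed

section \<open>Twisted polynomials in tau as functions\<close>

lemma tau_eval_eq_sum:
  assumes "\<And>i. n \<le> i \<Longrightarrow> coeff g i = 0"
  shows "tau_eval (g :: 'a::finite_field twisted_poly) x = (\<Sum>i<n. coeff g i * x ^ CARD('a) ^ i)"
  unfolding tau_eval_def by (rule sum_coeff_up_to[where F = "\<lambda>i c. c * x ^ CARD('a) ^ i"]) (simp_all add: assms)

lemma tau_eval_add: "tau_eval g (x + y) = tau_eval g x + tau_eval g y"
  by (simp add: tau_eval_def frobenius_power_kbar_add distrib_left sum.distrib)

lemma tau_eval_0 [simp]: "tau_eval (g :: 'a::finite_field twisted_poly) 0 = 0"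
  by (simp add: tau_eval_def power_0_left)

lemma tau_eval_1:
  "g \<in> A_tau \<Longrightarrow> tau_eval (g :: 'a::finite_field twisted_poly) 1 \<in> range A_to_kbar"
  by (auto simp: A_tau_def tau_eval_def intro!: range_A_to_kbar_sum)

text \<open>The difference of the values is an ordinary polynomial in \<open>x\<close> with
  exponents q^i. It vanishes on an infinite field, and as q > 1 the exponents are distinct, so each
  coefficient can be read off.\<close>

lemma tau_eval_inject:
  fixes g h :: "'a::finite_field twisted_poly"
  assumes "\<And>x. tau_eval g x = tau_eval h x"
  shows "g = h"
proof (rule poly_eqI)
  fix k
  define n where "n = Suc (max (degree g) (degree h))"
  define P where "P = (\<Sum>i<n. monom (coeff g i - coeff h i) (CARD('a) ^ i))"
  have high: "coeff g i = 0" "coeff h i = 0" if "n \<le> i" for i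
    using that by (auto simp: n_def coeff_eq_0)
  then have "poly P x = 0" for x
    using assms[of x] tau_eval_eq_sum[of n g x] tau_eval_eq_sum[of n h x]
    by (simp add: P_def poly_sum poly_monom left_diff_distrib sum_subtractf)
  then have "P = 0"
    using poly_roots_finite[of P] infinite_kbar[where 'a = 'a] by auto
  have "1 < CARD('a)"
  proof -
    have "card {0, 1 :: 'a} \<le> CARD('a)"
      by (rule card_mono) auto
    then show ?thesis
      by simp
  qed
  then have "coeff P (CARD('a) ^ k) = (\<Sum>i<n. if i = k then coeff g i - coeff h i else 0)"
    unfolding P_def coeff_sum by (intro sum.cong) (auto simp: power_inject_exp)
  then show "coeff g k = coeff h k"
    using \<open>P = 0\<close> high[of k] by (cases "k < n") auto
qed

text \<open>As S^k(x f) is x^(q^k) S^k(f) and c is linear, the coefficient of tau^k is entry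
  \<open>i\<close> of c(S^k f). The length of the sum depends on \<open>f\<close> alone, so one
  \<open>g\<close> serves all \<open>x\<close>.\<close>

lemma Delta_smult_eq_tau_eval:
  fixes f :: "'a::finite_field kbar poly vec"
  assumes "\<forall>n\<in>set s. 0 < n" "dim_vec f = length s" "integral_vec f" "i < dimE s"
  obtains g where "g \<in> A_tau" "\<And>x. Delta s ([:x:] \<cdot>\<^sub>v f) $ i = tau_eval g x"
proof -
  obtain n where n: "(sigma_quot s ^^ n) f = 0\<^sub>v (length s)"
    using assms(1,2) by (rule sigma_quot_nilpotent)
  define g where "g = (\<Sum>k<n. monom (low_coord s ((sigma_quot s ^^ k) f) i) k)"
  have g: "coeff g k = (if k < n then low_coord s ((sigma_quot s ^^ k) f) i else 0)" for k
    by (simp add: g_def coeff_sum)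
  have smult: "(sigma_quot s ^^ k) ([:x:] \<cdot>\<^sub>v f) = [:x ^ CARD('a) ^ k:] \<cdot>\<^sub>v (sigma_quot s ^^ k) f" for k x
    by (induction k) (simp_all add: sigma_quot_smult assms(2) power_mult mult.commute flip: power_mult)
  show ?thesis
  proof
    show "g \<in> A_tau"
      using assms by (auto simp: A_tau_def g range_A_to_kbar_closed
          intro: integral_low_coord integral_sigma_quot_funpow)
    fix x
    have "(sigma_quot s ^^ n) ([:x:] \<cdot>\<^sub>v f) = 0\<^sub>v (length s)"
      unfolding smult n by (rule eq_vecI) auto
    then have "Delta s ([:x:] \<cdot>\<^sub>v f) $ i = (\<Sum>k<n. low_coord s ((sigma_quot s ^^ k) ([:x:] \<cdot>\<^sub>v f)) i)"
      using assms by (intro Delta_eq_sum) auto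
    also have "\<dots> = (\<Sum>k<n. coeff g k * x ^ CARD('a) ^ k)"
      using assms by (simp add: smult low_coord_smult g mult.commute)
    also have "\<dots> = tau_eval g x"
      by (rule tau_eval_eq_sum[symmetric]) (simp add: g)
    finally show "Delta s ([:x:] \<cdot>\<^sub>v f) $ i = tau_eval g x" .
  qed
qed

text \<open>The case x = 1: a twisted polynomial over A takes at 1 the sum of its
  coefficients.\<close>

lemma integral_Delta:
  assumes "\<forall>n\<in>set s. 0 < n" "dim_vec f = length s" "integral_vec f"
  shows "Delta s f \<in> vec_A (dimE s)"
proof -
  have "Delta s f $ i \<in> range A_to_kbar" if i: "i < dimE s" for i
  proof -
    obtain g where g: "g \<in> A_tau" "\<And>x. Delta s ([:x:] \<cdot>\<^sub>v f) $ i = tau_eval g x"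
      using Delta_smult_eq_tau_eval[OF assms i] by blast
    have "[:1:] \<cdot>\<^sub>v f = f"
      by (simp flip: one_pCons)
    with g(2)[of 1] tau_eval_1[OF g(1)] show ?thesis
      by simp
  qed
  then show ?thesis
    using Delta_carrier[OF assms(1,2)] by (simp add: vec_A_def)
qed

subsection \<open>The matrix of t\<close>

definition t_act :: "'a::finite_field kbar poly vec \<Rightarrow> 'a kbar poly vec" where
  "t_act f = monom 1 1 \<cdot>\<^sub>v f"

lemma dim_t_act [simp]: "dim_vec (t_act f) = dim_vec f"
  by (simp add: t_act_def)

lemma t_act_add: "dim_vec f = dim_vec g \<Longrightarrow> t_act (f + g) = t_act f + t_act g"
  by (rule eq_vecI) (auto simp: t_act_def distrib_left)

text \<open>The only nonzero coefficient of t is 1, which the inverse twist fixes.\<close>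

lemma t_act_sigma: "dim_vec f = length s \<Longrightarrow> t_act (sigma s f) = sigma s (t_act f)"
  by (simp add: t_act_def sigma_smult inv_twist_def)

lemma t_act_nu_comb:
  "t_act (nu_comb s c) = vec (length s) (\<lambda>l. \<Sum>i<dimE s. ([:c i:] \<cdot>\<^sub>v t_act (nu_basis s ! i)) $ l)"
  by (rule eq_vecI) (auto simp: t_act_def nu_comb_def sum_distrib_left intro!: sum.cong)

lemma Delta_sum:
  fixes F :: "nat \<Rightarrow> 'a::finite_field kbar poly vec"
  assumes "\<forall>n\<in>set s. 0 < n" "\<And>i. i < m \<Longrightarrow> dim_vec (F i) = length s" "k < dimE s"
  shows "Delta s (vec (length s) (\<lambda>l. \<Sum>i<m. F i $ l)) $ k = (\<Sum>i<m. Delta s (F i) $ k)"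
  using assms(2)
proof (induction m)
  case 0
  have "vec (length s) (\<lambda>l. 0) = (0\<^sub>v (length s) :: 'a kbar poly vec)"
    by (rule eq_vecI) auto
  then show ?case
    using assms(3) by (simp add: Delta_zero)
next
  case (Suc m)
  have "vec (length s) (\<lambda>l. \<Sum>i<Suc m. F i $ l) = vec (length s) (\<lambda>l. \<Sum>i<m. F i $ l) + F m"
    using Suc.prems[of m] by (intro eq_vecI) auto
  then show ?case
    using Suc assms(1,3) by (simp add: Delta_add dim_Delta)
qed

lemma integral_t_act_nu_basis:
  assumes "j < dimE s"
  shows "integral_vec (t_act (nu_basis s ! j))"
proof -
  have "integral_poly (monom 1 1)"
    by (auto simp: integral_poly_def range_A_to_kbar_closed)
  then show ?thesis
    using assms unfolding integral_vec_def
    by (auto simp: t_act_def nu_basis_index intro!: integral_poly_mult integral_poly_power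
        integral_poly_t_minus_theta integral_poly_0)
qed

text \<open>Column \<open>j\<close> consists of the twisted polynomials for Delta of x t nu_j as
  functions of x. For general \<open>f\<close> the identity follows by induction along S: both sides
  are additive, t commutes with sigma and Delta absorbs sigma, so only the span of nu needs
  checking.\<close>

lemma t_matrix_exists:
  assumes "\<forall>n\<in>set s. 0 < n"
  obtains R :: "'a::finite_field twisted_poly mat" where "R \<in> Mat_A_tau (dimE s)"
    and "\<And>f. dim_vec f = length s \<Longrightarrow> tau_mat_apply R (Delta s f) = Delta s (t_act f)"
proof -
  have "\<exists>g. g \<in> A_tau \<and> (\<forall>x. Delta s ([:x:] \<cdot>\<^sub>v t_act (nu_basis s ! j)) $ i = tau_eval g (x :: 'a kbar))"
    if "i < dimE s" "j < dimE s" for i j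
  proof -
    have "dim_vec (t_act (nu_basis s ! j :: 'a kbar poly vec)) = length s"
      using that by simp
    from Delta_smult_eq_tau_eval[OF assms this integral_t_act_nu_basis[OF that(2)] that(1)]
    show ?thesis
      by blast
  qed
  then obtain G :: "nat \<Rightarrow> nat \<Rightarrow> 'a twisted_poly" where G: "\<And>i j. i < dimE s \<Longrightarrow> j < dimE s \<Longrightarrow> G i j \<in> A_tau"
    "\<And>i j x. i < dimE s \<Longrightarrow> j < dimE s \<Longrightarrow>
        Delta s ([:x:] \<cdot>\<^sub>v t_act (nu_basis s ! j)) $ i = tau_eval (G i j) x"
    by metis
  define R where "R = mat (dimE s) (dimE s) (\<lambda>(i, j). G i j)"
  have apply_R: "tau_mat_apply R x $ i = (\<Sum>j<dimE s. tau_eval (G i j) (x $ j))" if "i < dimE s" for x i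
    using that by (simp add: tau_mat_apply_def R_def)
  have dim_R [simp]: "dim_vec (tau_mat_apply R x) = dimE s" for x
    by (simp add: tau_mat_apply_def R_def)
  have "tau_mat_apply R (Delta s f) = Delta s (t_act f)" if f: "dim_vec f = length s" for f
  proof -
    obtain n where "(sigma_quot s ^^ n) f = 0\<^sub>v (length s)"
      using assms f by (rule sigma_quot_nilpotent)
    then show ?thesis
      using f
    proof (induction n arbitrary: f)
      case 0
      have "t_act (0\<^sub>v (length s)) = (0\<^sub>v (length s) :: 'a kbar poly vec)"
        by (rule eq_vecI) (auto simp: t_act_def)
      with 0 show ?case
        by (intro eq_vecI) (auto simp: apply_R Delta_zero)
    next
      case (Suc n)
      define g where "g = sigma_quot s f"
      define c where "c = low_coord s f"
      have g [simp]: "dim_vec g = length s"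
        by (simp add: g_def)
      have IH: "tau_mat_apply R (Delta s g) = Delta s (t_act g)"
        using Suc unfolding g_def by (intro Suc.IH) (auto simp: funpow_swap1)
      have f: "f = nu_comb s c + sigma s g"
        unfolding c_def g_def by (rule sigma_decomposition[OF Suc.prems(2)])
      have Delta_f: "Delta s f = vec (dimE s) c + Delta s g"
        by (simp add: f Delta_add[OF assms] Delta_nu_comb[OF assms] Delta_sigma[OF assms])
      have "Delta s (t_act f) = Delta s (t_act (nu_comb s c)) + Delta s (t_act g)"
        by (simp add: f t_act_add t_act_sigma Delta_add[OF assms] Delta_sigma[OF assms])
      moreover have "Delta s (t_act (nu_comb s c)) $ i = (\<Sum>j<dimE s. tau_eval (G i j) (c j))"
        if "i < dimE s" for i
        using that unfolding t_act_nu_comb by (simp add: Delta_sum[OF assms] G(2))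
      ultimately show ?case
        by (intro eq_vecI)
          (auto simp: Delta_f apply_R tau_eval_add sum.distrib dim_Delta[OF assms]
            IH[symmetric])
    qed
  qed
  moreover have "R \<in> Mat_A_tau (dimE s)"
    by (simp add: Mat_A_tau_def R_def G(1))
  ultimately show ?thesis
    using that by blast
qed

text \<open>All multiples of a unit vector are used as tests: they isolate one entry as a function
  of the scalar \<open>x\<close>, and \<open>tau_eval_inject\<close> applies.\<close>

lemma tau_matrix_unique:
  fixes R R' :: "'a::finite_field twisted_poly mat"
  assumes "R \<in> carrier_mat m d" "R' \<in> carrier_mat m d"
    and "\<And>x. x \<in> carrier_vec d \<Longrightarrow> tau_mat_apply R x = tau_mat_apply R' x"
  shows "R = R'"
proof (rule eq_matI)
  fix i j assume "i < dim_row R'" "j < dim_col R'"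
  then have i: "i < m" and j: "j < d"
    using assms(2) by auto
  have entry: "tau_mat_apply Q (x \<cdot>\<^sub>v unit_vec d j) $ i = tau_eval (Q $$ (i, j)) x"
    if "Q \<in> carrier_mat m d" for x and Q :: "'a twisted_poly mat"
  proof -
    have "tau_mat_apply Q (x \<cdot>\<^sub>v unit_vec d j) $ i
        = (\<Sum>k<d. tau_eval (Q $$ (i, k)) (x * (if k = j then 1 else 0)))"
      using that i j by (auto simp: tau_mat_apply_def intro!: sum.cong)
    also have "\<dots> = (\<Sum>k<d. if k = j then tau_eval (Q $$ (i, k)) x else 0)"
      by (rule sum.cong) auto
    finally show ?thesis
      using j by simp
  qed
  show "R $$ (i, j) = R' $$ (i, j)"
    using entry[OF assms(1)] entry[OF assms(2)] assms(3)[of "_ \<cdot>\<^sub>v unit_vec d j"]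
    by (intro tau_eval_inject) (metis smult_carrier_vec unit_vec_carrier)
qed (use assms in auto)

text \<open>The integral matrix from \<open>t_matrix_exists\<close> satisfies the description of
  \<open>rho\<close>; surjectivity of Delta makes it the only one.\<close>

lemma rho_t_integral:
  assumes "\<forall>n\<in>set s. 0 < n"
  shows "(rho s (monom 1 1) :: 'a::finite_field twisted_poly mat) \<in> Mat_A_tau (dimE s)"
proof -
  obtain R :: "'a twisted_poly mat" where R: "R \<in> Mat_A_tau (dimE s)"
    and apply_R: "\<And>f. dim_vec f = length s \<Longrightarrow> tau_mat_apply R (Delta s f) = Delta s (t_act f)"
    using t_matrix_exists[OF assms] by blast
  have "Fqt_to_kbart (monom 1 1 :: 'a poly) = monom 1 1"
    by (simp add: Fqt_to_kbart_def map_poly_monom one_pCons flip: A_to_kbar.hom_one)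
  then have *: "Fqt_to_kbart (monom 1 1 :: 'a poly) \<cdot>\<^sub>v f = t_act f" for f
    by (simp add: t_act_def)
  have "rho s (monom 1 1) = R"
    unfolding rho_def *
  proof (rule the_equality)
    fix Q :: "'a twisted_poly mat"
    assume Q: "Q \<in> carrier_mat (dimE s) (dimE s) \<and>
      (\<forall>m\<in>carrier_vec (length s). tau_mat_apply Q (Delta s m) = Delta s (t_act m))"
    show "Q = R"
    proof (rule tau_matrix_unique)
      fix x :: "'a kbar vec" assume "x \<in> carrier_vec (dimE s)"
      \<comment> \<open>An explicit preimage of \<open>x\<close>: its entries serve as constant
        coordinates.\<close>
      then have "x = Delta s (nu_comb s (\<lambda>i. x $ i))"
        unfolding Delta_nu_comb[OF assms] by auto
      then show "tau_mat_apply Q x = tau_mat_apply R x"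
        using Q apply_R by (metis dim_nu_comb nu_comb_carrier)
    qed (use Q R in \<open>auto simp: Mat_A_tau_def\<close>)
  qed (use R apply_R in \<open>auto simp: Mat_A_tau_def\<close>)
  with R show ?thesis
    by simp
qed

section \<open>The special point\<close>

text \<open>The last weight equals the last entry of \<open>s\<close>, so the power of t - theta in
  the special point is the one that sigma produces in the last row. The preimage under sigma is
  built from \<open>h\<close>, which carries H without its inverse twist.\<close>

lemma special_point_integral:
  assumes "s \<noteq> []" and "\<forall>n\<in>set s. 0 < n"
  shows "(special_point s :: 'a::finite_field kbar vec) \<in> vec_A (dimE s)"
proof -
  define r where "r = length s - 1"
  define h :: "'a kbar poly vec" where "h = H_poly s r \<cdot>\<^sub>v basis_m s r"
  have "drop r s = [s ! r]"
    using assms(1) Cons_nth_drop_Suc[of r s] by (simp add: r_def)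
  then have r: "r < length s" "Suc r = length s" "last s = s ! r" "weight s r = last s"
    using assms(1) by (simp_all add: r_def last_conv_nth weight_def)
  define f :: "'a kbar poly vec" where
    "f = (inv_twist (H_poly s r) * t_minus_theta ^ last s) \<cdot>\<^sub>v basis_m s r"
  have "integral_vec h"
    by (auto simp: h_def integral_vec_def integral_poly_H_poly integral_poly_0 unit_vec_def)
  have "sigma s (unipotent_inv s h) = f"
  proof (rule eq_vecI)
    fix j assume "j < dim_vec f"
    then have j: "j < length s"
      by (simp add: f_def)
    \<comment> \<open>The unipotent factor of sigma cancels \<open>unipotent_inv\<close>, leaving
      the inverse twist of \<open>h\<close> times powers of t - theta; rows before the last are
      0.\<close>
    show "sigma s (unipotent_inv s h) $ j = f $ j"
      unfolding sigma_index[OF j] unipotent_inv_rec[OF j]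
      using j r by (auto simp: h_def f_def)
  qed (simp add: f_def)
  then have "special_point s = Delta s (unipotent_inv s h)"
    unfolding Delta_sigma[OF assms(2) dim_unipotent_inv, symmetric]
    by (simp add: special_point_def f_def H_poly_def r r_def)
  then show ?thesis
    using integral_Delta[OF assms(2) dim_unipotent_inv] integral_unipotent_inv[OF \<open>integral_vec h\<close>, of s]
    by (simp add: h_def)
qed

theorem theorem5p3p4:
  fixes s :: "nat list"
  assumes "s \<noteq> []" and "\<forall>n\<in>set s. 0 < n"
  shows "(rho s (monom 1 1) :: 'a::finite_field twisted_poly mat) \<in> Mat_A_tau (dimE s)
       \<and> (special_point s :: 'a kbar vec) \<in> vec_A (dimE s)"
  using rho_t_integral special_point_integral assms by blast

end
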